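(* Assume $x^{\circ} \in X$ is a randomized point. Then $x^{\circ} \in X_E$ if and only if $X_E = X$.
   Context: Let $k \ge 2$ and $n \ge 2$ be integers and $c_1,\dots,c_k \in \mathbb{R}^n$. Let $X = \{x\in\mathbb{R}^n : \sum_{j=1}^n x_j = 1,\ x_j \ge 0 \text{ for all } j=1,\dots,n\}$. A point $x^{\circ}\in X$ is an efficient solution (of the problem of simultaneously maximizing $c_1^Tx,\dots,c_k^Tx$ over $X$) if there is no $x\in X$ with $c_i^Tx \ge c_i^Tx^{\circ}$ for all $i=1,\dots,k$ and at least one of these inequalities strict. $X_E$ denotes the set of all efficient solutions. A point $x\in X$ is randomized if $x_j>0$ for all $j=1,\dots,n$. *)

theory Defs
  imports "HOL-Analysis.Analysis"
begin

definition mixed_points :: "(real ^ 'n) set" where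
  "mixed_points = {x. (\<Sum>j\<in>UNIV. x $ j) = 1 \<and> (\<forall>j. x $ j \<ge> 0)}"

definition randomized :: "real ^ 'n \<Rightarrow> bool" where
  "randomized x \<longleftrightarrow> x \<in> mixed_points \<and> (\<forall>j. x $ j > 0)"

(* Only the values c 1, ..., c k of the sequence c matter. *)
definition efficient :: "nat \<Rightarrow> (nat \<Rightarrow> real ^ 'n) \<Rightarrow> (real ^ 'n) set" where
  "efficient k c = {x \<in> mixed_points.
     \<not> (\<exists>y \<in> mixed_points.
          (\<forall>i \<in> {1..k}. c i \<bullet> y \<ge> c i \<bullet> x) \<and> (\<exists>i \<in> {1..k}. c i \<bullet> y > c i \<bullet> x))}"

end

theory Submission
  imports Defs
begin

text \<open>
  Whether a point of the simplex is dominated depends only on the directions in which one may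
  move from it: \<open>y\<close> dominates \<open>x\<close> exactly when the objectives weakly increase, and one of them
  strictly, along \<open>y - x\<close>, and this property survives scaling by a positive factor. A randomized
  point lies in the relative interior of the simplex, so from it every direction \<open>y - x\<close> between
  two points of the simplex can be followed for a positive distance
  (\<open>randomized_move_in_mixed_points\<close>). Hence an improving direction at any point of the
  simplex is an improving direction at the randomized point, and if the latter is efficient then
  no point is dominated.
\<close>

lemma mixed_points_component_le_1:
  assumes "x \<in> mixed_points"
  shows "x $ j \<le> 1"
proof -
  have "x $ j \<le> (\<Sum>i\<in>UNIV. x $ i)"
    using assms by (intro member_le_sum) (auto simp: mixed_points_def)
  then show ?thesis
    using assms by (simp add: mixed_points_def)
qed

text \<open>
  The coordinates of \<open>y - x\<close> sum to zero, so moving along it preserves the coordinate sum, and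
  each of them is at least \<open>-1\<close>, so a step whose length is the smallest coordinate of \<open>z\<close> keeps
  all coordinates nonnegative.
\<close>

lemma randomized_move_in_mixed_points:
  fixes x y z :: "real ^ 'n"
  assumes z: "randomized z" and x: "x \<in> mixed_points" and y: "y \<in> mixed_points"
  shows "\<exists>e>0. z + e *\<^sub>R (y - x) \<in> mixed_points"
proof -
  define e where "e = Min (range (\<lambda>j. z $ j))"
  have "e > 0"
    using z by (auto simp: e_def randomized_def)
  have e_le: "e \<le> z $ j" for j
    by (simp add: e_def)
  have "(z + e *\<^sub>R (y - x)) $ j \<ge> 0" for j
  proof -
    have "y $ j \<ge> 0"
      using y by (simp add: mixed_points_def)
    then have "e * (y $ j - x $ j) \<ge> e * (- 1)"
      using mixed_points_component_le_1[OF x, of j] \<open>e > 0\<close> by (intro mult_left_mono) auto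
    then show ?thesis
      using e_le[of j] by simp
  qed
  moreover have "(\<Sum>j\<in>UNIV. (z + e *\<^sub>R (y - x)) $ j) = 1"
    using assms
    by (simp add: randomized_def mixed_points_def sum.distrib sum_subtractf
        flip: sum_distrib_left)
  ultimately show ?thesis
    using \<open>e > 0\<close> by (auto simp: mixed_points_def)
qed

theorem corollary1:
  fixes c :: "nat \<Rightarrow> real ^ 'n" and k :: nat and x0 :: "real ^ 'n"
  assumes "k \<ge> 2" and "CARD('n) \<ge> 2"
    and "randomized x0"
  shows "x0 \<in> efficient k c \<longleftrightarrow> efficient k c = mixed_points"
proof
  assume x0: "x0 \<in> efficient k c"
  have "x \<in> efficient k c" if x: "x \<in> mixed_points" for x
  proof (rule ccontr)
    assume "x \<notin> efficient k c"
    then obtain y where y: "y \<in> mixed_points"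
      and weak: "\<forall>i\<in>{1..k}. c i \<bullet> y \<ge> c i \<bullet> x"
      and strict: "\<exists>i\<in>{1..k}. c i \<bullet> y > c i \<bullet> x"
      using x by (auto simp: efficient_def)
    obtain e where "e > 0" and in_X: "x0 + e *\<^sub>R (y - x) \<in> mixed_points"
      using randomized_move_in_mixed_points[OF \<open>randomized x0\<close> x y] by blast
    have gain: "c i \<bullet> (x0 + e *\<^sub>R (y - x)) = c i \<bullet> x0 + e * (c i \<bullet> y - c i \<bullet> x)" for i
      by (simp add: inner_add_right inner_diff_right)
    have "\<forall>i\<in>{1..k}. c i \<bullet> (x0 + e *\<^sub>R (y - x)) \<ge> c i \<bullet> x0"
      unfolding gain using weak \<open>e > 0\<close> by simp
    moreover have "\<exists>i\<in>{1..k}. c i \<bullet> (x0 + e *\<^sub>R (y - x)) > c i \<bullet> x0"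
      unfolding gain using strict \<open>e > 0\<close> by (simp add: zero_less_mult_iff)
    ultimately show False
      using x0 in_X unfolding efficient_def by blast
  qed
  then show "efficient k c = mixed_points"
    by (auto simp: efficient_def)
next
  assume "efficient k c = mixed_points"
  then show "x0 \<in> efficient k c"
    using \<open>randomized x0\<close> by (simp add: randomized_def)
qed

end
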